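(* (i) For every $\varepsilon>0$, every $n$-point metric space has a subset of size at least $n^{1-\varepsilon}$ which embeds in Hilbert space with distortion $O\left(\frac{\log(1/\varepsilon)}{\varepsilon}\right)$, the implied constant being absolute. (ii) Stated in terms of the metric Ramsey functions: there exists an absolute constant $C>0$ such that for every $\alpha>1$ and every integer $n$, $$R_2(\alpha,n)\ \ge\ R_{\mathrm{UM}}(\alpha,n)\ \ge\ n^{1-C\frac{\log(2\alpha)}{\alpha}}.$$
   Context: For an embedding (injective map) $f:X\to Y$ between metric spaces, its distortion is $\mathrm{dist}(f)=\sup_{x\ne y}\frac{d_Y(f(x),f(y))}{d_X(x,y)}\cdot\sup_{x\neq y}\frac{d_X(x,y)}{d_Y(f(x),f(y))}$. $c_Y(X)$ is the least distortion with which $X$ may be embedded in $Y$, and $X$ $\alpha$-embeds into $Y$ if $c_Y(X)\le\alpha$. For a class $\mathcal M$ of metric spaces, $R_{\mathcal M}(\alpha,n)$ is the largest integer $m$ such that every $n$-point metric space has a subspace of size $m$ that $\alpha$-embeds into a member of $\mathcal M$. $R_2=R_{\{\ell_2\}}$. $\mathrm{UM}$ is the class of ultrametric spaces, i.e. metric spaces with $d(x,z)\le\max\{d(x,y),d(y,z)\}$ for all $x,y,z$.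
   Formalization: In (i) the distortion bound is C·max(1, log(1/ε)/ε), since log(1/ε)/ε tends to 0 as ε→1 and is negative for ε>1 while distortion of two or more points is at least 1; finite spaces and ultrametric targets are taken with natural-number points, without loss. *)

theory Defs
  imports "HOL-Analysis.Analysis"
begin

section \<open>Distortion\<close>

text \<open>
  Distortions take values in the extended nonnegative reals, so that both suprema and the infimum
  below are total operations: an unbounded ratio gives \<open>\<infinity>\<close>, and \<open>X\<close> has infinite least distortion
  in \<open>Y\<close> if there is no embedding at all. For a space with at most one point the suprema are over
  the empty set and the distortion is \<open>0\<close>; every other embedding has distortion at least \<open>1\<close>.
\<close>

definition distortion ::
  "'a set \<Rightarrow> ('a \<Rightarrow> 'a \<Rightarrow> real) \<Rightarrow> ('b \<Rightarrow> 'b \<Rightarrow> real) \<Rightarrow> ('a \<Rightarrow> 'b) \<Rightarrow> ennreal" where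
  "distortion X dX dY f =
     (SUP (x, y) \<in> {(x, y). x \<in> X \<and> y \<in> X \<and> x \<noteq> y}. ennreal (dY (f x) (f y) / dX x y)) *
     (SUP (x, y) \<in> {(x, y). x \<in> X \<and> y \<in> X \<and> x \<noteq> y}. ennreal (dX x y / dY (f x) (f y)))"

definition embedding_on :: "'a set \<Rightarrow> 'b set \<Rightarrow> ('a \<Rightarrow> 'b) \<Rightarrow> bool" where
  "embedding_on X Y f \<longleftrightarrow> inj_on f X \<and> f ` X \<subseteq> Y"

definition least_distortion ::
  "'b set \<Rightarrow> ('b \<Rightarrow> 'b \<Rightarrow> real) \<Rightarrow> 'a set \<Rightarrow> ('a \<Rightarrow> 'a \<Rightarrow> real) \<Rightarrow> ennreal" where
  "least_distortion Y dY X dX = (INF f \<in> {f. embedding_on X Y f}. distortion X dX dY f)"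

definition embeds_within ::
  "real \<Rightarrow> 'a set \<Rightarrow> ('a \<Rightarrow> 'a \<Rightarrow> real) \<Rightarrow> 'b set \<Rightarrow> ('b \<Rightarrow> 'b \<Rightarrow> real) \<Rightarrow> bool" where
  "embeds_within \<alpha> X dX Y dY \<longleftrightarrow> least_distortion Y dY X dX \<le> ennreal \<alpha>"


section \<open>Metric Ramsey functions\<close>

text \<open>
  A class of metric spaces is a set of pairs of a carrier and a distance function.

  Quantification over all \<open>n\<close>-point metric spaces is quantification over the \<open>n\<close>-point spaces whose
  points are natural numbers. A constant that is existentially quantified inside a formula could
  depend on a type variable of the theorem, so a fixed type is needed for constants to be absolute;
  by \<open>n_point_space_nat_isometric\<close> nothing is lost.
\<close>

type_synonym 'a metric_class = "('a set \<times> ('a \<Rightarrow> 'a \<Rightarrow> real)) set"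

definition n_point_space :: "nat \<Rightarrow> 'a set \<Rightarrow> ('a \<Rightarrow> 'a \<Rightarrow> real) \<Rightarrow> bool" where
  "n_point_space n X d \<longleftrightarrow> Metric_space X d \<and> finite X \<and> card X = n"

lemma n_point_space_nat_isometric:
  fixes X :: "'a set"
  assumes "n_point_space n X d"
  obtains N :: "nat set" and d' g where "n_point_space n N d'" and "bij_betw g N X"
    and "\<And>i j. i \<in> N \<Longrightarrow> j \<in> N \<Longrightarrow> d' i j = d (g i) (g j)"
proof -
  interpret Metric_space X d using assms by (simp add: n_point_space_def)
  have fin: "finite X" and card: "card X = n"
    using assms by (auto simp: n_point_space_def)
  obtain g where g: "bij_betw g {0..<n} X"
    using ex_bij_betw_nat_finite[OF fin] card by auto
  have mem: "g i \<in> X" if "i < n" for i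
    using g that by (auto simp: bij_betw_def)
  have inj: "g i = g j \<longleftrightarrow> i = j" if "i < n" "j < n" for i j
    using g that by (auto simp: bij_betw_def inj_on_def)
  have "Metric_space {0..<n} (\<lambda>i j. d (g i) (g j))"
    by unfold_locales (auto simp: mem inj commute intro: triangle)
  then have "n_point_space n {0..<n} (\<lambda>i j. d (g i) (g j))"
    by (simp add: n_point_space_def)
  then show thesis using g that by blast
qed

definition ramsey_size :: "'b metric_class \<Rightarrow> real \<Rightarrow> nat \<Rightarrow> nat \<Rightarrow> bool" where
  "ramsey_size \<M> \<alpha> n m \<longleftrightarrow>
     (\<forall>(X :: nat set) d. n_point_space n X d \<longrightarrow>
        (\<exists>S Y dY. S \<subseteq> X \<and> card S = m \<and> (Y, dY) \<in> \<M> \<and> embeds_within \<alpha> S d Y dY))"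

definition metric_ramsey :: "'b metric_class \<Rightarrow> real \<Rightarrow> nat \<Rightarrow> nat" where
  "metric_ramsey \<M> \<alpha> n = (GREATEST m. ramsey_size \<M> \<alpha> n m)"

lemma metric_ramsey_is_largest:
  assumes "\<M> \<noteq> {}"
  shows "ramsey_size \<M> \<alpha> n (metric_ramsey \<M> \<alpha> n)"
    and "ramsey_size \<M> \<alpha> n m \<Longrightarrow> m \<le> metric_ramsey \<M> \<alpha> n"
proof -
  obtain Y dY where Y: "(Y, dY) \<in> \<M>" using assms by auto
  have empty: "embeds_within \<alpha> {} d Y dY" for d :: "nat \<Rightarrow> nat \<Rightarrow> real"
  proof -
    have "least_distortion Y dY {} d \<le> distortion {} d dY undefined"
      unfolding least_distortion_def by (rule INF_lower) (simp add: embedding_on_def)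
    also have "distortion {} d dY undefined = 0"
      by (simp add: distortion_def bot_ennreal)
    finally show ?thesis
      by (simp add: embeds_within_def)
  qed
  have zero: "ramsey_size \<M> \<alpha> n 0"
    unfolding ramsey_size_def by (intro allI impI exI[of _ "{}"] exI[of _ Y] exI[of _ dY]) (simp add: empty Y)
  have bound: "m \<le> n" if "ramsey_size \<M> \<alpha> n m" for m
  proof -
    have "Metric_space {0..<n} (\<lambda>i j. if i = j then 0 else 1)"
      by unfold_locales auto
    then have "n_point_space n {0..<n} (\<lambda>i j. if i = j then 0 else 1)"
      by (simp add: n_point_space_def)
    with that have "\<exists>S Y dY. S \<subseteq> {0..<n} \<and> card S = m \<and> (Y, dY) \<in> \<M> \<and>
        embeds_within \<alpha> S (\<lambda>i j. if i = j then 0 else 1) Y dY"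
      unfolding ramsey_size_def by (elim allE impE)
    then obtain S where "S \<subseteq> {0..<n}" "card S = m" by (elim exE conjE)
    then show ?thesis using card_mono[of "{0..<n}" S] by simp
  qed
  show "ramsey_size \<M> \<alpha> n (metric_ramsey \<M> \<alpha> n)"
    unfolding metric_ramsey_def by (rule GreatestI_nat[of "ramsey_size \<M> \<alpha> n", OF zero bound])
  show "m \<le> metric_ramsey \<M> \<alpha> n" if "ramsey_size \<M> \<alpha> n m"
    unfolding metric_ramsey_def by (rule Greatest_le_nat[of "ramsey_size \<M> \<alpha> n", OF that bound])
qed


section \<open>Hilbert space and ultrametric spaces\<close>

text \<open>
  The sum in \<open>ell2_dist\<close> is an unconditional one, which is \<open>0\<close> rather than unspecified outside
  the carrier: \<^const>\<open>Metric_space\<close> asks for nonnegativity on the whole type.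
\<close>

definition ell2 :: "(nat \<Rightarrow> real) set" where
  "ell2 = {x. (\<lambda>i. (x i)\<^sup>2) summable_on UNIV}"

definition ell2_dist :: "(nat \<Rightarrow> real) \<Rightarrow> (nat \<Rightarrow> real) \<Rightarrow> real" where
  "ell2_dist x y = sqrt (\<Sum>\<^sub>\<infinity>i. (x i - y i)\<^sup>2)"

lemma ell2_diff_summable:
  assumes "x \<in> ell2" "y \<in> ell2"
  shows "(\<lambda>i. (x i - y i)\<^sup>2) summable_on UNIV"
proof (rule summable_on_comparison_test)
  show "(\<lambda>i. 2 * (x i)\<^sup>2 + 2 * (y i)\<^sup>2) summable_on UNIV"
    using assms by (intro summable_on_add summable_on_cmult_right) (auto simp: ell2_def)
  show "(x i - y i)\<^sup>2 \<le> 2 * (x i)\<^sup>2 + 2 * (y i)\<^sup>2" for i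
    using zero_le_power2[of "x i + y i"] by (simp add: power2_eq_square algebra_simps)
qed auto

lemma L2_set_le_ell2_dist:
  assumes "x \<in> ell2" "y \<in> ell2" "finite F"
  shows "L2_set (\<lambda>i. x i - y i) F \<le> ell2_dist x y"
  unfolding L2_set_def ell2_dist_def
  using ell2_diff_summable[OF assms(1,2)] assms(3)
  by (intro real_sqrt_le_mono finite_sum_le_infsum) auto

lemma Metric_space_ell2: "Metric_space ell2 ell2_dist"
proof
  fix x y z :: "nat \<Rightarrow> real"
  show "0 \<le> ell2_dist x y"
    by (auto simp: ell2_dist_def intro: infsum_nonneg)
  show "ell2_dist x y = ell2_dist y x"
    by (simp add: ell2_dist_def power2_commute)
  show "ell2_dist x y = 0 \<longleftrightarrow> x = y" if "x \<in> ell2" "y \<in> ell2"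
  proof
    assume "ell2_dist x y = 0"
    then have "\<bar>x i - y i\<bar> \<le> 0" for i
      using L2_set_le_ell2_dist[OF that, of "{i}"] by (simp add: L2_set_def)
    then show "x = y" by (simp add: fun_eq_iff)
  qed (simp add: ell2_dist_def)
  show "ell2_dist x z \<le> ell2_dist x y + ell2_dist y z"
    if xyz: "x \<in> ell2" "y \<in> ell2" "z \<in> ell2"
  proof -
    let ?B = "ell2_dist x y + ell2_dist y z"
    have B: "0 \<le> ?B"
      by (auto simp: ell2_dist_def intro!: add_nonneg_nonneg infsum_nonneg)
    have "(\<Sum>i\<in>F. (x i - z i)\<^sup>2) \<le> ?B\<^sup>2" if "finite F" for F
    proof -
      have "L2_set (\<lambda>i. x i - z i) F = L2_set (\<lambda>i. (x i - y i) + (y i - z i)) F"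
        by simp
      also have "\<dots> \<le> L2_set (\<lambda>i. x i - y i) F + L2_set (\<lambda>i. y i - z i) F"
        by (rule L2_set_triangle_ineq)
      also have "\<dots> \<le> ?B"
        using xyz that by (intro add_mono L2_set_le_ell2_dist)
      finally show ?thesis
        by (simp add: L2_set_def real_le_lsqrt sqrt_le_D)
    qed
    then have "(\<Sum>\<^sub>\<infinity>i. (x i - z i)\<^sup>2) \<le> ?B\<^sup>2"
      using ell2_diff_summable[OF xyz(1,3)] by (intro infsum_le_finite_sums) auto
    then show ?thesis
      unfolding ell2_dist_def[of x z] using B real_le_lsqrt by blast
  qed
qed

definition ell2_class :: "(nat \<Rightarrow> real) metric_class" where
  "ell2_class = {(ell2, ell2_dist)}"

definition ultrametric_class :: "'a metric_class" where
  "ultrametric_class =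
     {(Y, d). Metric_space Y d \<and> (\<forall>x\<in>Y. \<forall>y\<in>Y. \<forall>z\<in>Y. d x z \<le> max (d x y) (d y z))}"

abbreviation R_2 :: "real \<Rightarrow> nat \<Rightarrow> nat" where
  "R_2 \<equiv> metric_ramsey ell2_class"

text \<open>
  Ultrametrics on sets of natural numbers suffice: if a finite space has least distortion at most
  \<open>\<alpha>\<close> in some ultrametric space, then a sequence of embeddings approaching the infimum shows this,
  and the images of these embeddings lie in a countable ultrametric subspace.
\<close>

abbreviation R_UM :: "real \<Rightarrow> nat \<Rightarrow> nat" where
  "R_UM \<equiv> metric_ramsey (ultrametric_class :: nat metric_class)"

end

theory Submission
  imports Defs
begin

text \<open>
  Both parts follow from one stronger fact: for every positive integer \<open>k\<close>, an \<open>n\<close>-point metric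
  space contains at least \<open>n\<close> to the power \<open>1 - 1/k\<close> points on which the metric is within a factor
  \<open>8k\<close> of an ultrametric (\<open>large_ultrametric_subset\<close>). Taking \<open>k\<close> about \<open>1/\<epsilon>\<close> gives distortion
  \<open>O(1/\<epsilon>)\<close>, which is better than the logarithmic bounds claimed. As a finite ultrametric space embeds
  isometrically in Hilbert space (\<open>finite_ultrametric_isometric_ell2\<close>), the same subset serves for
  Hilbert space, and the metric Ramsey function of Hilbert space dominates that of ultrametrics.

  The subset is found by carving out balls (\<open>ultrametric_subset_by_ball_carving\<close>). Let \<open>Z\<close> have
  diameter \<open>E\<close>, and let \<open>u\<close> maximise the number of points in the ball of radius \<open>E/8\<close>. Increase
  the radius from \<open>E/8\<close> to \<open>E/4\<close> in \<open>k\<close> equal steps; some step enlarges the ball by at most the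
  \<open>k\<close>-th root of the total growth (\<open>exists_slow_growth_step\<close>). Drop the annulus of that step. The
  inner ball \<open>P\<close> and the outer part \<open>Q\<close> are then at distance at least \<open>E/(8k)\<close>, so that declaring
  all distances between them to be \<open>E\<close> costs a factor of at most \<open>8k\<close>; both parts are treated
  recursively.

  The loss is controlled by the potential \<open>card Z / m(Z) powr (1/k)\<close>, where \<open>m(Z)\<close> is the largest number of
  points of \<open>Z\<close> in a ball whose radius is a quarter of the diameter of \<open>Z\<close>; the recursion keeps at
  least this many points. Passing to \<open>Q\<close> does not increase \<open>m\<close>. The set \<open>P\<close> has diameter at most
  \<open>E/2\<close>, so by the choice of \<open>u\<close> the number \<open>m(P)\<close> is at most the size of the ball of radius \<open>E/8\<close>
  about \<open>u\<close>, whereas \<open>m(Z)\<close> is at least the size of the ball of radius \<open>E/4\<close>. The \<open>k\<close>-th root of the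
  ratio of these sizes is exactly what pays for the annulus. At the start \<open>m(Z) \<le> n\<close>.
\<close>

section \<open>Finite ultrametric spaces embed isometrically in Hilbert space\<close>

lemma finite_coordinates_ell2:
  fixes F :: "'a \<Rightarrow> 'i \<Rightarrow> real"
  assumes "finite I"
  obtains f where "\<And>x. f x \<in> ell2"
    and "\<And>x y. ell2_dist (f x) (f y) = L2_set (\<lambda>i. F x i - F y i) I"
proof -
  define g where "g = to_nat_on I"
  have inj: "inj_on g I"
    unfolding g_def using assms by (intro inj_on_to_nat_on countable_finite)
  define f where "f x n = (if n \<in> g ` I then F x (inv_into I g n) else 0)" for x n
  have "f x \<in> ell2" for x
    unfolding ell2_def mem_Collect_eq
  proof (rule finite_nonzero_values_imp_summable_on)
    show "finite {n \<in> UNIV. (f x n)\<^sup>2 \<noteq> 0}"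
      by (rule finite_subset[of _ "g ` I"]) (auto simp: f_def assms)
  qed
  moreover have "ell2_dist (f x) (f y) = L2_set (\<lambda>i. F x i - F y i) I" for x y
  proof -
    have "(\<Sum>\<^sub>\<infinity>n. (f x n - f y n)\<^sup>2) = (\<Sum>\<^sub>\<infinity>n\<in>g ` I. (f x n - f y n)\<^sup>2)"
      by (rule infsum_cong_neutral) (auto simp: f_def)
    also have "\<dots> = (\<Sum>n\<in>g ` I. (f x n - f y n)\<^sup>2)"
      using assms by simp
    also have "\<dots> = (\<Sum>i\<in>I. (F x i - F y i)\<^sup>2)"
      using inj by (simp add: sum.reindex f_def)
    finally show ?thesis by (simp add: ell2_dist_def L2_set_def)
  qed
  ultimately show thesis using that by blast
qed

text \<open>
  The weights are the increments of \<open>h\<close> along \<open>V\<close>, with the full value of \<open>h\<close> at the least element.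
\<close>

lemma cumulative_weights:
  fixes h :: "'a::linorder \<Rightarrow> real"
  assumes "finite V" and "\<And>t. t \<in> V \<Longrightarrow> 0 \<le> h t" and "mono_on V h"
  shows "\<exists>w. (\<forall>t\<in>V. 0 \<le> w t) \<and> (\<forall>s\<in>V. (\<Sum>t\<in>{t\<in>V. t \<le> s}. w t) = h s)"
  using assms
proof (induction V rule: finite_linorder_max_induct)
  case empty
  then show ?case by simp
next
  case (insert b V)
  have "mono_on V h"
    using insert.prems(2) by (rule mono_on_subset) auto
  with insert obtain w where w: "\<forall>t\<in>V. 0 \<le> w t"
    and sums: "\<forall>s\<in>V. (\<Sum>t\<in>{t\<in>V. t \<le> s}. w t) = h s"
    by auto
  have le: "(\<Sum>t\<in>V. w t) \<le> h b"
  proof (cases "V = {}")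
    case True
    then show ?thesis using insert.prems(1) by simp
  next
    case False
    have all: "{t\<in>V. t \<le> Max V} = V"
      using insert.hyps(1) by auto
    have "Max V \<in> V"
      using insert.hyps(1) False by simp
    then have "(\<Sum>t\<in>V. w t) = h (Max V)"
      using sums all by auto
    also have "\<dots> \<le> h b"
      using \<open>Max V \<in> V\<close> insert.hyps(2) insert.prems(2)
      by (intro mono_onD[of "insert b V" h]) (auto intro: less_imp_le)
    finally show ?thesis .
  qed
  have b: "b \<notin> V" using insert.hyps(2) by auto
  define w' where "w' = w(b := h b - (\<Sum>t\<in>V. w t))"
  have old: "(\<Sum>t\<in>A. w' t) = (\<Sum>t\<in>A. w t)" if "A \<subseteq> V" for A
    using b that by (intro sum.cong) (auto simp: w'_def)
  have "(\<Sum>t\<in>{t\<in>insert b V. t \<le> s}. w' t) = h s" if "s \<in> insert b V" for s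
  proof (cases "s = b")
    case True
    have "{t\<in>insert b V. t \<le> s} = insert b V"
      using True insert.hyps(2) by (auto intro: less_imp_le)
    then show ?thesis
      using True b insert.hyps(1) old[of V] by (simp add: w'_def)
  next
    case False
    then have s: "s \<in> V" using that by simp
    then have "{t\<in>insert b V. t \<le> s} = {t\<in>V. t \<le> s}"
      using insert.hyps(2) by (auto simp: not_le)
    then show ?thesis using s sums old[of "{t\<in>V. t \<le> s}"] by simp
  qed
  moreover have "\<forall>t\<in>insert b V. 0 \<le> w' t"
    using w le by (simp add: w'_def)
  ultimately show ?case by blast
qed

lemma sum_indicator_differences:
  fixes r :: real
  assumes "finite B" "a \<in> B" "b \<in> B"
  shows "(\<Sum>c\<in>B. ((if c = a then r else 0) - (if c = b then r else 0))\<^sup>2)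
       = (if a = b then 0 else 2 * r\<^sup>2)"
proof (cases "a = b")
  case False
  then have "(\<Sum>c\<in>B. ((if c = a then r else 0) - (if c = b then r else 0))\<^sup>2)
      = (\<Sum>c\<in>B. (if c = a then r\<^sup>2 else 0) + (if c = b then r\<^sup>2 else 0))"
    by (intro sum.cong) auto
  then show ?thesis
    using assms False by (simp add: sum.distrib)
qed simp

text \<open>
  In an ultrametric space the open balls of a fixed radius \<open>t > 0\<close> are the classes of an equivalence
  relation. For every value \<open>t\<close> of the metric and every class \<open>A\<close> at level \<open>t\<close> there is one
  coordinate, a multiple of the indicator of \<open>A\<close>. Two points \<open>x\<close> and \<open>y\<close> are in different classes at
  exactly the levels \<open>0 < t \<le> d x y\<close>, and there they differ in two coordinates. Hence their squared
  distance is a sum of weights over these levels, and the weights can be chosen such that this sum is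
  \<open>(d x y)\<^sup>2\<close>.
\<close>

lemma finite_ultrametric_isometric_ell2:
  fixes Y :: "'a set"
  assumes "(Y, d) \<in> ultrametric_class" and "finite Y"
  obtains f where "\<And>x. f x \<in> ell2"
    and "\<And>x y. x \<in> Y \<Longrightarrow> y \<in> Y \<Longrightarrow> ell2_dist (f x) (f y) = d x y"
proof -
  interpret Metric_space Y d
    using assms(1) by (simp add: ultrametric_class_def)
  have ultra: "d x z \<le> max (d x y) (d y z)" if "x \<in> Y" "y \<in> Y" "z \<in> Y" for x y z
    using assms(1) that by (simp add: ultrametric_class_def)
  define V where "V = (\<lambda>(x, y). d x y) ` (Y \<times> Y)"
  have V: "finite V" "\<And>t. t \<in> V \<Longrightarrow> 0 \<le> t"
    using assms(2) by (auto simp: V_def)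
  have "mono_on V (\<lambda>t. t\<^sup>2)"
    using V(2) by (intro mono_onI power_mono) auto
  then obtain w where w: "\<forall>t\<in>V. 0 \<le> w t"
    and sums: "\<forall>s\<in>V. (\<Sum>t\<in>{t\<in>V. t \<le> s}. w t) = s\<^sup>2"
    using cumulative_weights[OF V(1), of "\<lambda>t. t\<^sup>2"] by auto
  define C where "C t x = {z\<in>Y. d x z < t}" for t x
  have C_eq: "C t x = C t y \<longleftrightarrow> d x y < t" if xy: "x \<in> Y" "y \<in> Y" and t: "0 < t" for t x y
  proof
    assume "C t x = C t y"
    moreover have "y \<in> C t y" using xy t by (simp add: C_def)
    ultimately have "y \<in> C t x" by simp
    then show "d x y < t" by (simp add: C_def)
  next
    assume less: "d x y < t"
    have "d y z < t" if "d x z < t" "z \<in> Y" for z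
      using ultra[of y x z] xy that less commute[of x y] by simp
    moreover have "d x z < t" if "d y z < t" "z \<in> Y" for z
      using ultra[of x y z] xy that less by simp
    ultimately show "C t x = C t y" by (auto simp: C_def)
  qed
  define F where "F x = (\<lambda>(t, A). if A = C t x then sqrt (w t / 2) else 0)" for x
  have fin: "finite (V \<times> Pow Y)" using V(1) assms(2) by simp
  obtain f where f: "\<And>x. f x \<in> ell2"
    "\<And>x y. ell2_dist (f x) (f y) = L2_set (\<lambda>i. F x i - F y i) (V \<times> Pow Y)"
    using finite_coordinates_ell2[OF fin, of F] by blast
  have "ell2_dist (f x) (f y) = d x y" if xy: "x \<in> Y" "y \<in> Y" for x y
  proof -
    have "(\<Sum>i\<in>V \<times> Pow Y. (F x i - F y i)\<^sup>2)
        = (\<Sum>t\<in>V. \<Sum>A\<in>Pow Y. (F x (t, A) - F y (t, A))\<^sup>2)"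
      by (simp add: sum.cartesian_product case_prod_unfold)
    also have "\<dots> = (\<Sum>t\<in>V. if C t x = C t y then 0 else w t)"
    proof (rule sum.cong)
      fix t assume "t \<in> V"
      then show "(\<Sum>A\<in>Pow Y. (F x (t, A) - F y (t, A))\<^sup>2) = (if C t x = C t y then 0 else w t)"
        using sum_indicator_differences[of "Pow Y" "C t x" "C t y" "sqrt (w t / 2)"] w assms(2)
        by (auto simp: F_def C_def)
    qed simp
    also have "\<dots> = (\<Sum>t\<in>V. if t \<le> d x y then w t else 0)"
    proof (rule sum.cong)
      fix t assume t: "t \<in> V"
      show "(if C t x = C t y then 0 else w t) = (if t \<le> d x y then w t else 0)"
      proof (cases "t = 0")
        case True
        \<comment> \<open>All open balls of radius \<open>0\<close> are empty, so this level separates no points; its weight is \<open>0\<^sup>2\<close>.\<close>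
        have "{s\<in>V. s \<le> 0} = {0}" using V(2) t True by force
        then have "w t = 0" using sums t True by auto
        then show ?thesis by simp
      next
        case False
        then show ?thesis using C_eq[OF xy, of t] V(2)[OF t] by auto
      qed
    qed simp
    also have "\<dots> = (\<Sum>t\<in>{t\<in>V. t \<le> d x y}. w t)"
      using V(1) by (simp add: sum.If_cases Int_def)
    also have "\<dots> = (d x y)\<^sup>2"
      using sums xy by (auto simp: V_def)
    finally show ?thesis by (simp add: f(2) L2_set_def)
  qed
  with f(1) show thesis using that by blast
qed

section \<open>Large subsets close to an ultrametric\<close>

text \<open>
  If every step multiplied \<open>a\<close> by more than the geometric mean of the growth factors, the total growth
  would exceed \<open>a k / a 0\<close>.
\<close>

lemma exists_slow_growth_step:
  fixes a :: "nat \<Rightarrow> real"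
  assumes "0 < k" and pos: "0 < a 0" "0 < a k"
  shows "\<exists>i<k. a (Suc i) \<le> a i * (a k / a 0) powr (1 / k)"
proof (rule ccontr)
  define q where "q = (a k / a 0) powr (1 / k)"
  assume "\<not> (\<exists>i<k. a (Suc i) \<le> a i * (a k / a 0) powr (1 / k))"
  then have step: "a i * q < a (Suc i)" if "i < k" for i
    using that by (auto simp: q_def not_le)
  have q: "0 < q" using pos by (simp add: q_def)
  have less: "j < k \<Longrightarrow> a 0 * q ^ Suc j < a (Suc j)" for j
  proof (induction j)
    case 0
    then show ?case using step[of 0] by simp
  next
    case (Suc j)
    then have "a 0 * q ^ Suc j < a (Suc j)" by simp
    then have "a 0 * q ^ Suc j * q < a (Suc j) * q"
      using q by (rule mult_strict_right_mono)
    also have "\<dots> < a (Suc (Suc j))" using step[of "Suc j"] Suc.prems by simp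
    finally show ?case by (simp add: ac_simps)
  qed
  have "q ^ k = a k / a 0"
    using q pos assms(1) by (simp add: q_def powr_realpow[symmetric] powr_powr)
  then show False
    using less[of "k - 1"] assms(1) pos by simp
qed

lemma ultrametric_class_subset:
  assumes "(Y, d) \<in> ultrametric_class" "S \<subseteq> Y"
  shows "(S, d) \<in> ultrametric_class"
  using assms Metric_space.subspace[of Y d S] by (auto simp: ultrametric_class_def subset_iff)

text \<open>
  A triangle with vertices in both parts has at least two sides of length \<open>D\<close>, and no side is longer.
\<close>

lemma ultrametric_class_glue:
  assumes A: "(A, dA) \<in> ultrametric_class" "\<And>x y. x \<in> A \<Longrightarrow> y \<in> A \<Longrightarrow> dA x y \<le> D"
    and B: "(B, dB) \<in> ultrametric_class" "\<And>x y. x \<in> B \<Longrightarrow> y \<in> B \<Longrightarrow> dB x y \<le> D"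
    and disj: "A \<inter> B = {}" and D: "0 < D"
  shows "(A \<union> B, \<lambda>x y. if x \<in> A \<and> y \<in> A then dA x y else if x \<in> B \<and> y \<in> B then dB x y else D)
           \<in> ultrametric_class"
    (is "(_, ?d) \<in> _")
proof -
  interpret A: Metric_space A dA using A(1) by (simp add: ultrametric_class_def)
  interpret B: Metric_space B dB using B(1) by (simp add: ultrametric_class_def)
  have uA: "dA x z \<le> max (dA x y) (dA y z)" if "x \<in> A" "y \<in> A" "z \<in> A" for x y z
    using A(1) that by (simp add: ultrametric_class_def)
  have uB: "dB x z \<le> max (dB x y) (dB y z)" if "x \<in> B" "y \<in> B" "z \<in> B" for x y z
    using B(1) that by (simp add: ultrametric_class_def)
  have nonneg: "0 \<le> ?d x y" for x y using D by simp
  have bound: "?d x y \<le> D" for x y using A(2) B(2) by simp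
  have cross: "?d x y = D" if "\<not> (x \<in> A \<and> y \<in> A)" "\<not> (x \<in> B \<and> y \<in> B)" for x y
    using that by auto
  have ultra: "?d x z \<le> max (?d x y) (?d y z)"
    if "x \<in> A \<union> B" "y \<in> A \<union> B" "z \<in> A \<union> B" for x y z
  proof -
    consider "x \<in> A" "y \<in> A" "z \<in> A" | "x \<in> B" "y \<in> B" "z \<in> B"
      | "\<not> (x \<in> A \<and> y \<in> A)" "\<not> (x \<in> B \<and> y \<in> B)"
      | "\<not> (y \<in> A \<and> z \<in> A)" "\<not> (y \<in> B \<and> z \<in> B)"
      using that disj by blast
    then show ?thesis
    proof cases
      case 1
      then show ?thesis using uA by simp
    next
      case 2
      then have "x \<notin> A" "y \<notin> A" "z \<notin> A" using disj by auto
      then show ?thesis using 2 uB by simp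
    next
      case 3
      then show ?thesis using bound[of x z] cross[OF 3] by (simp only: max.coboundedI1)
    next
      case 4
      then show ?thesis using bound[of x z] cross[OF 4] by (simp only: max.coboundedI2)
    qed
  qed
  have "Metric_space (A \<union> B) ?d"
  proof
    fix x y z
    show "0 \<le> ?d x y" by (rule nonneg)
    show "?d x y = ?d y x" by (auto simp: A.commute B.commute)
    show "?d x y = 0 \<longleftrightarrow> x = y" if "x \<in> A \<union> B" "y \<in> A \<union> B"
      using that D disj by auto
    show "?d x z \<le> ?d x y + ?d y z" if "x \<in> A \<union> B" "y \<in> A \<union> B" "z \<in> A \<union> B"
      using ultra[OF that] nonneg[of x y] nonneg[of y z] by linarith
  qed
  then show ?thesis using ultra unfolding ultrametric_class_def by blast
qed

text \<open>
  The induction for the carving argument. The diameter and the maximal ball size enter as upper bounds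
  \<open>D\<close> and \<open>m\<close>, so that both may be inherited by subsets; the bound of \<open>\<rho>\<close> by \<open>D\<close> is what allows the
  ultrametrics of the two parts to be glued.
\<close>

lemma ultrametric_subset_by_ball_carving:
  fixes d :: "'a \<Rightarrow> 'a \<Rightarrow> real"
  assumes X: "Metric_space X d" and k: "0 < k"
    and "finite Z" "Z \<subseteq> X"
    and "\<And>x y. x \<in> Z \<Longrightarrow> y \<in> Z \<Longrightarrow> d x y \<le> D"
    and "\<And>u. u \<in> Z \<Longrightarrow> real (card {y\<in>Z. d u y \<le> D / 4}) \<le> m"
  shows "\<exists>S \<rho>. S \<subseteq> Z \<and> real (card Z) \<le> real (card S) * m powr (1 / real k) \<and>
           (S, \<rho>) \<in> ultrametric_class \<and>
           (\<forall>x\<in>S. \<forall>y\<in>S. d x y \<le> \<rho> x y \<and> \<rho> x y \<le> 8 * real k * d x y \<and> \<rho> x y \<le> D)"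
  using assms(3-)
proof (induction "card Z" arbitrary: Z D m rule: less_induct)
  case less
  interpret Metric_space X d by (rule X)
  note fin = \<open>finite Z\<close> and ZX = \<open>Z \<subseteq> X\<close> and diam = less.prems(3) and m = less.prems(4)
  show ?case
  proof (cases "\<exists>x\<in>Z. \<exists>y\<in>Z. x \<noteq> y")
    case False
    have "Metric_space Z (\<lambda>_ _. 0)"
      by unfold_locales (use False in auto)
    then have UM: "(Z, \<lambda>_ _. 0) \<in> ultrametric_class"
      by (simp add: ultrametric_class_def)
    have bounds: "d x y = 0 \<and> 0 \<le> D" if "x \<in> Z" "y \<in> Z" for x y
    proof -
      have "x = y" "x \<in> X" using that False ZX by auto
      then show ?thesis using diam[OF that] by simp
    qed
    have "real (card Z) \<le> real (card Z) * m powr (1 / real k)"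
    proof (cases "Z = {}")
      case False
      then obtain u where u: "u \<in> Z" by auto
      then have "u \<in> {y\<in>Z. d u y \<le> D / 4}" using bounds by simp
      then have "0 < card {y\<in>Z. d u y \<le> D / 4}" using fin by (auto simp: card_gt_0_iff)
      then have "1 \<le> m" using m[OF u] by linarith
      then have "1 \<le> m powr (1 / real k)" by (simp add: ge_one_powr_ge_zero)
      then show ?thesis by (simp add: mult_le_cancel_left1)
    qed simp
    then show ?thesis
      using UM bounds by (intro exI[of _ Z] exI[of _ "\<lambda>_ _. 0"]) auto
  next
    case True
    \<comment> \<open>The exact diameter is needed here: it guarantees that the ball \<open>P\<close> below is a proper subset.\<close>
    define E where "E = Max ((\<lambda>(x, y). d x y) ` (Z \<times> Z))"
    have fin2: "finite ((\<lambda>(x, y). d x y) ` (Z \<times> Z))" using fin by simp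
    have E_ub: "d x y \<le> E" if "x \<in> Z" "y \<in> Z" for x y
      unfolding E_def using that fin2 by (intro Max_ge) auto
    have "E \<in> (\<lambda>(x, y). d x y) ` (Z \<times> Z)"
      unfolding E_def using fin2 True by (intro Max_in) auto
    then obtain x0 y0 where xy0: "x0 \<in> Z" "y0 \<in> Z" "E = d x0 y0" by auto
    have ED: "E \<le> D" using xy0 diam by simp
    have E: "0 < E"
    proof -
      obtain x y where xy: "x \<in> Z" "y \<in> Z" "x \<noteq> y" using True by blast
      then have "0 < d x y" using ZX mdist_pos_less by (meson subsetD)
      then show ?thesis using E_ub[OF xy(1,2)] by linarith
    qed
    obtain u where u: "u \<in> Z"
      and umax: "\<And>v. v \<in> Z \<Longrightarrow> card {y\<in>Z. d v y \<le> E / 8} \<le> card {y\<in>Z. d u y \<le> E / 8}"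
    proof -
      let ?N = "\<lambda>v. card {y\<in>Z. d v y \<le> E / 8}"
      have "Max (?N ` Z) \<in> ?N ` Z" using fin True by (intro Max_in) auto
      then obtain u where u: "u \<in> Z" "Max (?N ` Z) = ?N u" by (rule imageE)
      have "?N v \<le> ?N u" if "v \<in> Z" for v
        unfolding u(2)[symmetric] using fin that by (intro Max_ge) auto
      then show thesis by (rule that[OF u(1)])
    qed
    define r where "r i = E / 8 + real i * (E / (8 * real k))" for i
    define a where "a i = real (card {y\<in>Z. d u y \<le> r i})" for i
    have r0: "r 0 = E / 8" by (simp add: r_def)
    have rk: "r k = E / 4" using k by (simp add: r_def field_simps)
    have r_step: "r (Suc i) = r i + E / (8 * real k)" for i
      by (simp add: r_def algebra_simps add_divide_distrib)
    have r_pos: "0 < r i" for i using E by (simp add: r_def add_pos_nonneg)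
    have r_mono: "r i \<le> r j" if "i \<le> j" for i j
      using that E by (simp add: r_def divide_right_mono mult_right_mono)
    have a_pos: "0 < a i" for i
    proof -
      have "u \<in> {y\<in>Z. d u y \<le> r i}" using u ZX r_pos[of i] by (auto simp: less_imp_le)
      then show ?thesis using fin by (auto simp: a_def card_gt_0_iff)
    qed
    obtain i where i: "i < k" "a (Suc i) \<le> a i * (a k / a 0) powr (1 / real k)"
      using exists_slow_growth_step[of k a] k a_pos by auto
    define P where "P = {y\<in>Z. d u y \<le> r i}"
    define Q where "Q = {y\<in>Z. r (Suc i) < d u y}"
    have PZ: "P \<subseteq> Z" and QZ: "Q \<subseteq> Z" by (auto simp: P_def Q_def)
    have P_diam: "d x y \<le> E / 2" if "x \<in> P" "y \<in> P" for x y
    proof -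
      have "d x y \<le> d x u + d u y"
        using that u ZX PZ by (intro triangle) auto
      then show ?thesis
        using that r_mono[of i k] i(1) rk commute[of x u] by (simp add: P_def)
    qed
    have Q_diam: "d x y \<le> E" if "x \<in> Q" "y \<in> Q" for x y
      using that QZ by (intro E_ub) auto
    have "P \<noteq> Z"
      using P_diam[of x0 y0] xy0 E by auto
    then have cardP: "card P < card Z" using PZ fin by (intro psubset_card_mono) auto
    have "u \<notin> Q" using u ZX r_pos[of "Suc i"] by (auto simp: Q_def)
    then have cardQ: "card Q < card Z" using u QZ fin by (intro psubset_card_mono) auto
    have gap: "E \<le> 8 * real k * d x y" if "x \<in> P" "y \<in> Q" for x y
    proof -
      have "d u y \<le> d u x + d x y"
        using that u ZX PZ QZ by (intro triangle) auto
      then have "E / (8 * real k) \<le> d x y"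
        using that r_step[of i] by (simp add: P_def Q_def)
      then show ?thesis using k by (simp add: field_simps)
    qed
    have "\<exists>S \<rho>. S \<subseteq> P \<and> real (card P) \<le> real (card S) * a 0 powr (1 / real k) \<and>
           (S, \<rho>) \<in> ultrametric_class \<and>
           (\<forall>x\<in>S. \<forall>y\<in>S. d x y \<le> \<rho> x y \<and> \<rho> x y \<le> 8 * real k * d x y \<and> \<rho> x y \<le> E / 2)"
    proof (rule less.hyps[OF cardP])
      fix v assume v: "v \<in> P"
      have "card {y\<in>P. d v y \<le> E / 2 / 4} \<le> card {y\<in>Z. d v y \<le> E / 8}"
        using fin PZ by (intro card_mono) auto
      also have "\<dots> \<le> card {y\<in>Z. d u y \<le> E / 8}" using umax v PZ by blast
      finally show "real (card {y\<in>P. d v y \<le> E / 2 / 4}) \<le> a 0" by (simp add: a_def r0)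
    qed (use PZ fin ZX P_diam in \<open>auto intro: finite_subset\<close>)
    then obtain S \<rho> where S: "S \<subseteq> P" "real (card P) \<le> real (card S) * a 0 powr (1 / real k)"
      "(S, \<rho>) \<in> ultrametric_class"
      "\<And>x y. x \<in> S \<Longrightarrow> y \<in> S \<Longrightarrow> d x y \<le> \<rho> x y \<and> \<rho> x y \<le> 8 * real k * d x y \<and> \<rho> x y \<le> E / 2"
      by blast
    have "\<exists>T \<sigma>. T \<subseteq> Q \<and> real (card Q) \<le> real (card T) * m powr (1 / real k) \<and>
           (T, \<sigma>) \<in> ultrametric_class \<and>
           (\<forall>x\<in>T. \<forall>y\<in>T. d x y \<le> \<sigma> x y \<and> \<sigma> x y \<le> 8 * real k * d x y \<and> \<sigma> x y \<le> E)"
    proof (rule less.hyps[OF cardQ])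
      fix v assume v: "v \<in> Q"
      have "card {y\<in>Q. d v y \<le> E / 4} \<le> card {y\<in>Z. d v y \<le> D / 4}"
        using fin QZ ED by (intro card_mono) auto
      then show "real (card {y\<in>Q. d v y \<le> E / 4}) \<le> m"
        using m[of v] v QZ by (meson of_nat_mono order_trans subsetD)
    qed (use QZ fin ZX Q_diam in \<open>auto intro: finite_subset\<close>)
    then obtain T \<sigma> where T: "T \<subseteq> Q" "real (card Q) \<le> real (card T) * m powr (1 / real k)"
      "(T, \<sigma>) \<in> ultrametric_class"
      "\<And>x y. x \<in> T \<Longrightarrow> y \<in> T \<Longrightarrow> d x y \<le> \<sigma> x y \<and> \<sigma> x y \<le> 8 * real k * d x y \<and> \<sigma> x y \<le> E"
      by blast
    have disj: "S \<inter> T = {}"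
      using S(1) T(1) r_mono[of i "Suc i"] by (fastforce simp: P_def Q_def)
    define \<tau> where "\<tau> x y = (if x \<in> S \<and> y \<in> S then \<rho> x y
        else if x \<in> T \<and> y \<in> T then \<sigma> x y else E)" for x y
    have UM: "(S \<union> T, \<tau>) \<in> ultrametric_class"
      unfolding \<tau>_def
    proof (rule ultrametric_class_glue[OF S(3) _ T(3) _ disj E])
      show "\<rho> x y \<le> E" if "x \<in> S" "y \<in> S" for x y
        using S(4)[OF that] E by linarith
      show "\<sigma> x y \<le> E" if "x \<in> T" "y \<in> T" for x y
        using T(4)[OF that] by blast
    qed
    have bounds: "d x y \<le> \<tau> x y \<and> \<tau> x y \<le> 8 * real k * d x y \<and> \<tau> x y \<le> D"
      if xy: "x \<in> S \<union> T" "y \<in> S \<union> T" for x y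
    proof -
      consider "x \<in> S" "y \<in> S" | "x \<in> T" "y \<in> T" | "x \<in> S" "y \<in> T" | "x \<in> T" "y \<in> S"
        using xy by blast
      then show ?thesis
      proof cases
        case 1
        then show ?thesis using S(4)[of x y] E ED by (simp add: \<tau>_def)
      next
        case 2
        then have "x \<notin> S" using disj by auto
        then show ?thesis using 2 T(4)[of x y] ED by (simp add: \<tau>_def)
      next
        case 3
        then have "\<tau> x y = E" using disj by (auto simp: \<tau>_def)
        then show ?thesis using 3 gap[of x y] E_ub[of x y] ED S(1) T(1) PZ QZ by auto
      next
        case 4
        then have "\<tau> x y = E" using disj by (auto simp: \<tau>_def)
        then show ?thesis
          using 4 gap[of y x] E_ub[of x y] ED S(1) T(1) PZ QZ commute[of x y] by auto
      qed
    qed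
    have "real (card Z) \<le> real (card (S \<union> T)) * m powr (1 / real k)"
    proof -
      have "Z = {y\<in>Z. d u y \<le> r (Suc i)} \<union> Q" by (auto simp: Q_def)
      then have "card Z = card {y\<in>Z. d u y \<le> r (Suc i)} + card Q"
        using fin by (subst card_Un_disjoint[symmetric]) (auto simp: Q_def)
      then have split: "real (card Z) = a (Suc i) + real (card Q)" by (simp add: a_def)
      have "card {y\<in>Z. d u y \<le> r k} \<le> card {y\<in>Z. d u y \<le> D / 4}"
        using fin ED rk by (intro card_mono) auto
      then have akm: "a k \<le> m" using m[OF u] by (simp add: a_def)
      \<comment> \<open>The powers of \<open>a 0\<close> cancel: the gain in \<open>m\<close> from \<open>Z\<close> to \<open>P\<close> pays for the annulus.\<close>
      have "a (Suc i) \<le> a i * (a k / a 0) powr (1 / real k)" by (rule i(2))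
      also have "\<dots> \<le> (real (card S) * a 0 powr (1 / real k)) * (a k / a 0) powr (1 / real k)"
        using S(2) by (intro mult_right_mono) (auto simp: a_def P_def)
      also have "\<dots> = real (card S) * a k powr (1 / real k)"
        using a_pos[of 0] a_pos[of k] by (simp add: powr_divide)
      also have "\<dots> \<le> real (card S) * m powr (1 / real k)"
        using akm a_pos[of k] by (intro mult_left_mono powr_mono2) auto
      finally have "real (card Z) \<le> (real (card S) + real (card T)) * m powr (1 / real k)"
        using split T(2) by (simp add: algebra_simps)
      also have "real (card S) + real (card T) = real (card (S \<union> T))"
      proof -
        have "finite S" "finite T" using S(1) T(1) PZ QZ fin by (meson finite_subset)+
        then show ?thesis using disj by (simp add: card_Un_disjoint)
      qed
      finally show ?thesis .
    qed
    then show ?thesis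
      using UM bounds S(1) T(1) PZ QZ by (intro exI[of _ "S \<union> T"] exI[of _ \<tau>]) auto
  qed
qed

lemma large_ultrametric_subset:
  fixes d :: "'a \<Rightarrow> 'a \<Rightarrow> real"
  assumes "n_point_space n X d" and k: "0 < k"
  obtains S \<rho> where "S \<subseteq> X" "real n powr (1 - 1 / real k) \<le> real (card S)"
    "(S, \<rho>) \<in> ultrametric_class"
    "\<forall>x\<in>S. \<forall>y\<in>S. d x y \<le> \<rho> x y \<and> \<rho> x y \<le> 8 * real k * d x y"
proof -
  have X: "Metric_space X d" and fin: "finite X" and card: "card X = n"
    using assms(1) by (auto simp: n_point_space_def)
  define D where "D = Max ((\<lambda>(x, y). d x y) ` (X \<times> X))"
  have diam: "d x y \<le> D" if "x \<in> X" "y \<in> X" for x y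
    unfolding D_def using that fin by (intro Max_ge) auto
  have balls: "real (card {y\<in>X. d u y \<le> D / 4}) \<le> real n" for u
    using fin card card_mono[of X "{y\<in>X. d u y \<le> D / 4}"] by auto
  obtain S \<rho> where S: "S \<subseteq> X" "real n \<le> real (card S) * real n powr (1 / real k)"
    "(S, \<rho>) \<in> ultrametric_class"
    "\<forall>x\<in>S. \<forall>y\<in>S. d x y \<le> \<rho> x y \<and> \<rho> x y \<le> 8 * real k * d x y \<and> \<rho> x y \<le> D"
    using ultrametric_subset_by_ball_carving[OF X k fin subset_refl diam balls] card by auto
  have "real n powr (1 - 1 / real k) \<le> real (card S)"
  proof (cases "n = 0")
    case False
    then show ?thesis using S(2) by (simp add: powr_diff divide_le_eq)
  qed simp
  with S show thesis using that by blast
qed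

section \<open>Distortion\<close>

lemma distortion_le:
  assumes "0 \<le> K"
    and pos: "\<And>x y. x \<in> X \<Longrightarrow> y \<in> X \<Longrightarrow> x \<noteq> y \<Longrightarrow> 0 < dX x y"
    and bounds: "\<And>x y. x \<in> X \<Longrightarrow> y \<in> X \<Longrightarrow> dX x y \<le> dY (f x) (f y) \<and> dY (f x) (f y) \<le> K * dX x y"
  shows "distortion X dX dY f \<le> ennreal K"
proof -
  have "(SUP (x, y) \<in> {(x, y). x \<in> X \<and> y \<in> X \<and> x \<noteq> y}. ennreal (dY (f x) (f y) / dX x y))
      \<le> ennreal K"
    using pos bounds assms(1) by (intro SUP_least) (auto simp: divide_le_eq intro!: ennreal_leI)
  moreover have "ennreal (dX x y / dY (f x) (f y)) \<le> 1" if "x \<in> X" "y \<in> X" "x \<noteq> y" for x y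
    using pos[OF that] bounds[OF that(1,2)] by (simp add: ennreal_le_1)
  then have "(SUP (x, y) \<in> {(x, y). x \<in> X \<and> y \<in> X \<and> x \<noteq> y}. ennreal (dX x y / dY (f x) (f y)))
      \<le> 1"
    by (intro SUP_least) auto
  ultimately have "distortion X dX dY f \<le> ennreal K * 1"
    unfolding distortion_def by (intro mult_mono) auto
  then show ?thesis by simp
qed

lemma distortion_isometry:
  assumes "\<And>x y. x \<in> X \<Longrightarrow> y \<in> X \<Longrightarrow> dZ (g (f x)) (g (f y)) = dY (f x) (f y)"
  shows "distortion X dX dZ (g \<circ> f) = distortion X dX dY f"
  unfolding distortion_def
  by (intro arg_cong2[where f = "(*)"] SUP_cong) (auto simp: assms)

text \<open>
  The least distortion is an infimum that need not be attained, so the comparison is made for each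
  embedding \<open>f\<close> in \<open>Y\<close> separately; only the finite image of \<open>f\<close> has to be embedded in Hilbert space.
\<close>

lemma embeds_within_ultrametric_imp_ell2:
  assumes "finite S" "(Y, dY) \<in> ultrametric_class" "embeds_within \<alpha> S d Y dY"
  shows "embeds_within \<alpha> S d ell2 ell2_dist"
proof -
  have "least_distortion ell2 ell2_dist S d \<le> distortion S d dY f" if f: "embedding_on S Y f" for f
  proof -
    have inj: "inj_on f S" and sub: "f ` S \<subseteq> Y" using f by (auto simp: embedding_on_def)
    have UM: "(f ` S, dY) \<in> ultrametric_class"
      using assms(2) sub by (rule ultrametric_class_subset)
    then interpret Metric_space "f ` S" dY by (simp add: ultrametric_class_def)
    obtain g where g: "\<And>x. g x \<in> ell2"
      "\<And>x y. x \<in> f ` S \<Longrightarrow> y \<in> f ` S \<Longrightarrow> ell2_dist (g x) (g y) = dY x y"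
      using finite_ultrametric_isometric_ell2[OF UM] assms(1) by blast
    have "inj_on g (f ` S)"
      by (intro inj_onI) (metis g(2) zero)
    then have "embedding_on S ell2 (g \<circ> f)"
      using inj g(1) by (auto simp: embedding_on_def intro: comp_inj_on)
    then have "least_distortion ell2 ell2_dist S d \<le> distortion S d ell2_dist (g \<circ> f)"
      unfolding least_distortion_def by (intro INF_lower) simp
    also have "\<dots> = distortion S d dY f"
      by (rule distortion_isometry) (simp add: g(2))
    finally show ?thesis .
  qed
  then have "least_distortion ell2 ell2_dist S d \<le> least_distortion Y dY S d"
    unfolding least_distortion_def[of Y] by (intro INF_greatest) auto
  then show ?thesis using assms(3) by (auto simp: embeds_within_def)
qed

section \<open>The metric Ramsey functions\<close>

lemma ultrametric_class_nonempty: "(ultrametric_class :: 'a metric_class) \<noteq> {}"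
proof -
  have "Metric_space {} (\<lambda>(_::'a) _. 0)" by unfold_locales auto
  then have "({}, \<lambda>(_::'a) _. 0) \<in> ultrametric_class" by (simp add: ultrametric_class_def)
  then show ?thesis by blast
qed

lemma R_UM_le_R_2: "R_UM \<alpha> n \<le> R_2 \<alpha> n"
proof (rule metric_ramsey_is_largest(2))
  show "ell2_class \<noteq> {}" by (simp add: ell2_class_def)
  have UM: "ramsey_size (ultrametric_class :: nat metric_class) \<alpha> n (R_UM \<alpha> n)"
    by (rule metric_ramsey_is_largest(1)[OF ultrametric_class_nonempty])
  show "ramsey_size ell2_class \<alpha> n (R_UM \<alpha> n)"
    unfolding ramsey_size_def
  proof (intro allI impI)
    fix X :: "nat set" and d
    assume X: "n_point_space n X d"
    then obtain S and Y :: "nat set" and dY where S: "S \<subseteq> X" "card S = R_UM \<alpha> n"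
      "(Y, dY) \<in> ultrametric_class" "embeds_within \<alpha> S d Y dY"
      using UM unfolding ramsey_size_def by blast
    have "finite S" using S(1) X by (auto simp: n_point_space_def intro: finite_subset)
    then have "embeds_within \<alpha> S d ell2 ell2_dist"
      using S(3,4) by (rule embeds_within_ultrametric_imp_ell2)
    then show "\<exists>S Y dY. S \<subseteq> X \<and> card S = R_UM \<alpha> n \<and> (Y, dY) \<in> ell2_class \<and> embeds_within \<alpha> S d Y dY"
      using S(1,2) by (auto simp: ell2_class_def)
  qed
qed

text \<open>
  The Ramsey function asks for one size \<open>m\<close> that works for all spaces, while the subsets found above
  have various sizes; they are cut down to a common one, the bound rounded up.
\<close>

lemma R_UM_lower_bound:
  assumes k: "0 < k" and K: "8 * real k \<le> \<alpha>"
  shows "real n powr (1 - 1 / real k) \<le> real (R_UM \<alpha> n)"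
proof -
  define m where "m = nat \<lceil>real n powr (1 - 1 / real k)\<rceil>"
  have "ramsey_size (ultrametric_class :: nat metric_class) \<alpha> n m"
    unfolding ramsey_size_def
  proof (intro allI impI)
    fix X :: "nat set" and d
    assume X: "n_point_space n X d"
    obtain T \<rho> where T: "T \<subseteq> X" "real n powr (1 - 1 / real k) \<le> real (card T)"
      "(T, \<rho>) \<in> ultrametric_class"
      "\<forall>x\<in>T. \<forall>y\<in>T. d x y \<le> \<rho> x y \<and> \<rho> x y \<le> 8 * real k * d x y"
      by (rule large_ultrametric_subset[OF X k])
    have "m \<le> card T" using T(2) by (simp add: m_def nat_le_iff ceiling_le_iff)
    then obtain S where S: "S \<subseteq> T" "card S = m"
      by (meson obtain_subset_with_card_n)
    interpret Metric_space X d using X by (simp add: n_point_space_def)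
    have "distortion S d \<rho> id \<le> ennreal \<alpha>"
    proof (rule distortion_le)
      fix x y assume xy: "x \<in> S" "y \<in> S"
      then have "\<rho> x y \<le> 8 * real k * d x y" "d x y \<le> \<rho> x y" using T(4) S(1) by blast+
      moreover have "8 * real k * d x y \<le> \<alpha> * d x y" using K by (intro mult_right_mono) auto
      ultimately show "d x y \<le> \<rho> (id x) (id y) \<and> \<rho> (id x) (id y) \<le> \<alpha> * d x y" by simp
      assume "x \<noteq> y"
      then show "0 < d x y" using xy S(1) T(1) by (meson mdist_pos_less subsetD)
    qed (use K in linarith)
    moreover have "embedding_on S S id" by (simp add: embedding_on_def)
    ultimately have "embeds_within \<alpha> S d S \<rho>"
      unfolding embeds_within_def least_distortion_def by (auto intro: INF_lower2)
    then show "\<exists>S Y dY. S \<subseteq> X \<and> card S = m \<and> (Y, dY) \<in> (ultrametric_class :: nat metric_class) \<and>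
        embeds_within \<alpha> S d Y dY"
      using S T(1) ultrametric_class_subset[OF T(3) S(1)] by blast
  qed
  then have "m \<le> R_UM \<alpha> n"
    by (rule metric_ramsey_is_largest(2)[OF ultrametric_class_nonempty])
  moreover have "real n powr (1 - 1 / real k) \<le> real m" by (simp add: m_def real_nat_ceiling_ge)
  ultimately show ?thesis by linarith
qed

lemma distortion_singleton: "distortion {x} d d' f = 0"
proof -
  have "{(y, z). y \<in> {x} \<and> z \<in> {x} \<and> y \<noteq> z} = {}" by auto
  then show ?thesis unfolding distortion_def by (simp only: image_empty Sup_empty bot_ennreal mult_zero_left)
qed

lemma R_UM_ge_1:
  assumes "0 < n"
  shows "1 \<le> R_UM \<alpha> n"
proof (rule metric_ramsey_is_largest(2)[OF ultrametric_class_nonempty])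
  show "ramsey_size (ultrametric_class :: nat metric_class) \<alpha> n 1"
    unfolding ramsey_size_def
  proof (intro allI impI)
    fix X :: "nat set" and d
    assume X: "n_point_space n X d"
    then obtain x where x: "x \<in> X" using assms by (force simp: n_point_space_def)
    have "Metric_space {x} (\<lambda>_ _. 0)" by unfold_locales auto
    then have "({x}, \<lambda>_ _. 0) \<in> ultrametric_class" by (simp add: ultrametric_class_def)
    moreover have "embedding_on {x} {x} id" by (simp add: embedding_on_def)
    then have "embeds_within \<alpha> {x} d {x} (\<lambda>_ _. 0)"
      unfolding embeds_within_def least_distortion_def
      by (auto intro!: INF_lower2[of id] simp: distortion_singleton)
    ultimately show "\<exists>S Y dY. S \<subseteq> X \<and> card S = 1 \<and> (Y, dY) \<in> (ultrametric_class :: nat metric_class) \<and>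
        embeds_within \<alpha> S d Y dY"
      using x by (intro exI[of _ "{x}"] exI[of _ "\<lambda>_ _. 0"]) auto
  qed
qed

text \<open>
  With \<open>k\<close> the least integer not below \<open>1/\<epsilon>\<close>, the distortion \<open>8k\<close> is at most \<open>16/\<epsilon>\<close>. The logarithm is at
  least \<open>1\<close> once \<open>1/\<epsilon> \<ge> 3\<close>, and below that \<open>1/\<epsilon>\<close> is bounded by \<open>3\<close>; this gives the constant \<open>48\<close>.
  For \<open>\<epsilon> \<ge> 1\<close> a single point is enough.
\<close>

lemma large_ell2_subset:
  fixes X :: "'a set"
  assumes X: "n_point_space n X d" and \<epsilon>: "0 < \<epsilon>"
  obtains S f where "S \<subseteq> X" "real n powr (1 - \<epsilon>) \<le> real (card S)" "embedding_on S ell2 f"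
    "distortion S d ell2_dist f \<le> ennreal (48 * max 1 (ln (1 / \<epsilon>) / \<epsilon>))"
proof (cases "\<epsilon> < 1 \<and> 0 < n")
  case False
  have zero: "(\<lambda>_. 0) \<in> ell2" by (simp add: ell2_def)
  show thesis
  proof (cases "n = 0")
    case True
    show thesis
      by (rule that[of "{}" "\<lambda>_ _. 0"]) (simp_all add: True embedding_on_def distortion_def bot_ennreal)
  next
    case n: False
    then obtain x where x: "x \<in> X" using X by (force simp: n_point_space_def)
    have "real n powr (1 - \<epsilon>) \<le> real n powr 0" using n False by (intro powr_mono) auto
    then show thesis
      using x n by (intro that[of "{x}" "\<lambda>_ _. 0"]) (auto simp: embedding_on_def distortion_singleton zero)
  qed
next
  case True
  define k where "k = nat \<lceil>1 / \<epsilon>\<rceil>"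
  have k_ge: "1 / \<epsilon> \<le> real k" by (simp add: k_def real_nat_ceiling_ge)
  have "1 < 1 / \<epsilon>" using \<epsilon> True by simp
  then have k: "0 < k"
    using k_ge by (cases k) auto
  have "real k < 1 / \<epsilon> + 1"
    using \<open>1 < 1 / \<epsilon>\<close> unfolding k_def by linarith
  then have k_le: "real k \<le> 2 / \<epsilon>"
    using \<open>1 < 1 / \<epsilon>\<close> by (simp add: field_simps)
  obtain S \<rho> where S: "S \<subseteq> X" "real n powr (1 - 1 / real k) \<le> real (card S)"
    "(S, \<rho>) \<in> ultrametric_class"
    "\<forall>x\<in>S. \<forall>y\<in>S. d x y \<le> \<rho> x y \<and> \<rho> x y \<le> 8 * real k * d x y"
    by (rule large_ultrametric_subset[OF X k])
  interpret X: Metric_space X d using X by (simp add: n_point_space_def)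
  interpret S: Metric_space S \<rho> using S(3) by (simp add: ultrametric_class_def)
  have "finite S" using S(1) X by (auto simp: n_point_space_def intro: finite_subset)
  then obtain f where f: "\<And>x. f x \<in> ell2"
    "\<And>x y. x \<in> S \<Longrightarrow> y \<in> S \<Longrightarrow> ell2_dist (f x) (f y) = \<rho> x y"
    using finite_ultrametric_isometric_ell2[OF S(3)] by blast
  have "1 / real k \<le> \<epsilon>" using k_ge k \<epsilon> by (simp add: field_simps)
  then have "real n powr (1 - \<epsilon>) \<le> real n powr (1 - 1 / real k)"
    using True by (intro powr_mono) auto
  with S(2) have size: "real n powr (1 - \<epsilon>) \<le> real (card S)" by linarith
  have "inj_on f S" by (intro inj_onI) (metis f(2) S.zero)
  then have emb: "embedding_on S ell2 f" using f(1) by (auto simp: embedding_on_def)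
  have "distortion S d ell2_dist f \<le> ennreal (8 * real k)"
  proof (rule distortion_le)
    show "0 < d x y" if "x \<in> S" "y \<in> S" "x \<noteq> y" for x y
      using that S(1) by (meson X.mdist_pos_less subsetD)
  qed (use S(4) f(2) in auto)
  also have "\<dots> \<le> ennreal (48 * max 1 (ln (1 / \<epsilon>) / \<epsilon>))"
  proof (rule ennreal_leI)
    have "1 / \<epsilon> \<le> 3 * max 1 (ln (1 / \<epsilon>) / \<epsilon>)"
    proof (cases "3 \<le> 1 / \<epsilon>")
      case True
      have "exp 1 \<le> 1 / \<epsilon>" using True exp_le by linarith
      then have "1 \<le> ln (1 / \<epsilon>)" using \<epsilon> by (subst ln_ge_iff) auto
      then have "1 / \<epsilon> \<le> ln (1 / \<epsilon>) / \<epsilon>" using \<epsilon> by (intro divide_right_mono) auto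
      moreover have "0 < 1 / \<epsilon>" using \<epsilon> by simp
      ultimately show ?thesis by linarith
    next
      case False
      then show ?thesis by linarith
    qed
    then show "8 * real k \<le> 48 * max 1 (ln (1 / \<epsilon>) / \<epsilon>)" using k_le by linarith
  qed
  finally show thesis using that S(1) size emb by blast
qed

text \<open>
  For \<open>\<alpha> \<ge> 8\<close> the integer part \<open>k\<close> of \<open>\<alpha>/8\<close> satisfies \<open>1/k \<le> 16/\<alpha>\<close>. For \<open>\<alpha> < 8\<close> the constant makes
  the exponent negative, and a single point is enough. As \<open>ln (2 * \<alpha>) \<ge> 1/2\<close>, the constant \<open>32\<close>
  covers both ranges.
\<close>

lemma R_UM_lower_bound_log:
  assumes \<alpha>: "1 < \<alpha>"
  shows "real n powr (1 - 32 * (ln (2 * \<alpha>) / \<alpha>)) \<le> real (R_UM \<alpha> n)"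
proof (cases "n = 0")
  case False
  have "ln 2 \<le> ln (2 * \<alpha>)" using \<alpha> by simp
  then have "1 / 2 \<le> ln (2 * \<alpha>)" using ln2_ge_two_thirds by linarith
  then have "(1 / 2) / \<alpha> \<le> ln (2 * \<alpha>) / \<alpha>" using \<alpha> by (intro divide_right_mono) auto
  then have log: "16 / \<alpha> \<le> 32 * (ln (2 * \<alpha>) / \<alpha>)" by simp
  show ?thesis
  proof (cases "\<alpha> < 8")
    case True
    have "1 \<le> 16 / \<alpha>" using True \<alpha> by (simp add: le_divide_eq)
    then have "real n powr (1 - 32 * (ln (2 * \<alpha>) / \<alpha>)) \<le> real n powr 0"
      using log False by (intro powr_mono) linarith+
    also have "\<dots> \<le> real (R_UM \<alpha> n)" using R_UM_ge_1[of n \<alpha>] False by simp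
    finally show ?thesis .
  next
    case large: False
    define k where "k = nat \<lfloor>\<alpha> / 8\<rfloor>"
    have k: "1 \<le> k" "real k \<le> \<alpha> / 8" "\<alpha> / 8 < real k + 1"
      using large unfolding k_def by (simp_all add: le_nat_iff le_floor_iff) linarith+
    have "1 / real k \<le> 16 / \<alpha>" using k \<alpha> by (simp add: field_simps)
    then have "real n powr (1 - 32 * (ln (2 * \<alpha>) / \<alpha>)) \<le> real n powr (1 - 1 / real k)"
      using log False by (intro powr_mono) linarith+
    also have "\<dots> \<le> real (R_UM \<alpha> n)" using k by (intro R_UM_lower_bound) auto
    finally show ?thesis .
  qed
qed simp

theorem theorem1p3:
  shows "(\<exists>C>0. \<forall>\<epsilon>::real. \<epsilon> > 0 \<longrightarrow>
            (\<forall>n (X :: nat set) d. n_point_space n X d \<longrightarrow>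
               (\<exists>S f. S \<subseteq> X \<and> real (card S) \<ge> real n powr (1 - \<epsilon>) \<and> embedding_on S ell2 f \<and>
                  distortion S d ell2_dist f \<le> ennreal (C * max 1 (ln (1 / \<epsilon>) / \<epsilon>)))))
       \<and> (\<exists>C>0. \<forall>\<alpha>::real. \<alpha> > 1 \<longrightarrow>
            (\<forall>n. R_2 \<alpha> n \<ge> R_UM \<alpha> n \<and>
                 real (R_UM \<alpha> n) \<ge> real n powr (1 - C * (ln (2 * \<alpha>) / \<alpha>))))"
proof
  show "\<exists>C>0. \<forall>\<epsilon>::real. \<epsilon> > 0 \<longrightarrow>
            (\<forall>n (X :: nat set) d. n_point_space n X d \<longrightarrow>
               (\<exists>S f. S \<subseteq> X \<and> real (card S) \<ge> real n powr (1 - \<epsilon>) \<and> embedding_on S ell2 f \<and>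
                  distortion S d ell2_dist f \<le> ennreal (C * max 1 (ln (1 / \<epsilon>) / \<epsilon>))))"
  proof (intro exI[of _ 48] conjI allI impI)
    fix \<epsilon> :: real and n and X :: "nat set" and d
    assume "0 < \<epsilon>" and "n_point_space n X d"
    from this(2,1) obtain S f where "S \<subseteq> X" "real n powr (1 - \<epsilon>) \<le> real (card S)" "embedding_on S ell2 f"
      "distortion S d ell2_dist f \<le> ennreal (48 * max 1 (ln (1 / \<epsilon>) / \<epsilon>))"
      by (rule large_ell2_subset)
    then show "\<exists>S f. S \<subseteq> X \<and> real n powr (1 - \<epsilon>) \<le> real (card S) \<and> embedding_on S ell2 f \<and>
        distortion S d ell2_dist f \<le> ennreal (48 * max 1 (ln (1 / \<epsilon>) / \<epsilon>))"
      by blast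
  qed simp
  show "\<exists>C>0. \<forall>\<alpha>::real. \<alpha> > 1 \<longrightarrow>
            (\<forall>n. R_2 \<alpha> n \<ge> R_UM \<alpha> n \<and>
                 real (R_UM \<alpha> n) \<ge> real n powr (1 - C * (ln (2 * \<alpha>) / \<alpha>)))"
    using R_UM_le_R_2 R_UM_lower_bound_log by (intro exI[of _ 32]) simp
qed

end
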